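(* Let $l\ge0$ and let $\alpha,\eta$ be any given learning rates. Suppose the embedded input matrix takes the form $$\boldsymbol H^{(2l)}=\begin{bmatrix}\boldsymbol z_1&\cdots&\boldsymbol z_n&\boldsymbol z_{n+1}\\ \boldsymbol x_1&\cdots&\boldsymbol x_n&\boldsymbol x_{n+1}\\ y_1&\cdots&y_n&0\\ \boldsymbol\Theta^{(l)}_{:,1}&\cdots&\boldsymbol\Theta^{(l)}_{:,1}&\boldsymbol\Theta^{(l)}_{:,1}\\ \vdots&&\vdots&\vdots\\ \boldsymbol\Theta^{(l)}_{:,p}&\cdots&\boldsymbol\Theta^{(l)}_{:,p}&\boldsymbol\Theta^{(l)}_{:,p}\\ \boldsymbol\beta^{(l)}&\cdots&\boldsymbol\beta^{(l)}&\boldsymbol\beta^{(l)}\\ \hat{\boldsymbol x}^{(l)}_1&\cdots&\hat{\boldsymbol x}^{(l)}_n&\hat{\boldsymbol x}^{(l)}_{n+1}\\ 1&\cdots&1&1\\ 1&\cdots&1&0\end{bmatrix}\in\mathbb R^{D\times(n+1)},\qquad D=qp+3p+q+3,$$ where $\boldsymbol z_i\in\mathbb R^q$, $\boldsymbol x_i\in\mathbb R^p$, $y_i\in\mathbb R$, $\boldsymbol\Theta^{(l)}\in\mathbb R^{q\times p}$, $\boldsymbol\beta^{(l)}\in\mathbb R^p$, $\hat{\boldsymbol x}_i^{(l)}\in\mathbb R^p$. Given $\boldsymbol H^{(2l)}$, there exists a double-layer attention-only transformer block, with parameters $\{(\boldsymbol Q_m^{(s)},\boldsymbol K_m^{(s)},\boldsymbol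 V_m^{(s)})\}_{m\in[M^{(s)}]}\subset\mathbb R^{D\times D}$ for $s=2l+1,2l+2$ and numbers of heads $M^{(2l+1)}=2p$ and $M^{(2l+2)}=2(p+1)$, whose output on $\boldsymbol H^{(2l)}$ is $$\boldsymbol H^{(2(l+1))}=\begin{bmatrix}\boldsymbol z_1&\cdots&\boldsymbol z_n&\boldsymbol z_{n+1}\\ \boldsymbol x_1&\cdots&\boldsymbol x_n&\boldsymbol x_{n+1}\\ y_1&\cdots&y_n&0\\ \boldsymbol\Theta^{(l+1)}_{:,1}&\cdots&\boldsymbol\Theta^{(l+1)}_{:,1}&\boldsymbol\Theta^{(l+1)}_{:,1}\\ \vdots&&\vdots&\vdots\\ \boldsymbol\Theta^{(l+1)}_{:,p}&\cdots&\boldsymbol\Theta^{(l+1)}_{:,p}&\boldsymbol\Theta^{(l+1)}_{:,p}\\ \boldsymbol\beta^{(l+1)}&\cdots&\boldsymbol\beta^{(l+1)}&\boldsymbol\beta^{(l+1)}\\ \hat{\boldsymbol x}^{(l+1)}_1&\cdots&\hat{\boldsymbol x}^{(l+1)}_n&\hat{\boldsymbol x}^{(l+1)}_{n+1}\\ 1&\cdots&1&1\\ 1&\cdots&1&0\end{bmatrix}\in\mathbb R^{D\times(n+1)},$$ where $\boldsymbol\Theta^{(l+1)},\boldsymbol\beta^{(l+1)}$ are given by the two-stage least squares gradient update $$\boldsymbol\Theta^{(l+1)}=\boldsymbol\Theta^{(l)}-\eta\boldsymbol Z^\top(\boldsymbol Z\boldsymbol\Theta^{(l)}-\boldsymbol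 X),\qquad \boldsymbol\beta^{(l+1)}=\boldsymbol\beta^{(l)}-\alpha\boldsymbol\Theta^{(l)\top}\boldsymbol Z^\top(\boldsymbol Z\boldsymbol\Theta^{(l)}\boldsymbol\beta^{(l)}-\boldsymbol Y),$$ and $\hat{\boldsymbol x}_i^{(l+1)}=\boldsymbol\Theta^{(l)\top}\boldsymbol z_i$ for $i=1,\dots,n+1$.
   Context: $\boldsymbol Z\in\mathbb R^{n\times q}$, $\boldsymbol X\in\mathbb R^{n\times p}$, $\boldsymbol Y\in\mathbb R^n$ have rows $\boldsymbol z_i^\top,\boldsymbol x_i^\top,y_i$ for $i=1,\dots,n$ (the $(n+1)$-th column is an unlabeled query and is not used in the update). $\boldsymbol\Theta_{:,k}$ denotes the $k$-th column of $\boldsymbol\Theta$. Attention layer: with $M$ heads and parameters $\{(\boldsymbol Q_m,\boldsymbol K_m,\boldsymbol V_m)\}_{m\in[M]}\subset\mathbb R^{D\times D}$, an attention layer maps $\boldsymbol H=[\boldsymbol h_1,\dots,\boldsymbol h_{N}]\in\mathbb R^{D\times N}$ to the matrix with columns $$\tilde{\boldsymbol h}_i=\boldsymbol h_i+\sum_{m=1}^M\frac1{N}\sum_{j=1}^{N}\sigma(\langle\boldsymbol Q_m\boldsymbol h_i,\boldsymbol K_m\boldsymbol h_j\rangle)\,\boldsymbol V_m\boldsymbol h_j,\qquad i=1,\dots,N,$$ where $\sigma$ is the ReLU function $\sigma(a)=\max(a,0)$ and $N$ is the number of columns of the input (here $N=n+1$). A double-layer attention-only transformer block is the composition of two attention layers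 (no MLP layers). *)

theory Defs
  imports "Jordan_Normal_Form.Matrix"
begin

text \<open>
  Vector and matrix indices start at 0: the labelled samples are the columns \<open>0, \<dots>, n - 1\<close>
  and the unlabelled query is column \<open>n\<close>.
\<close>

definition relu :: "real \<Rightarrow> real" where
  "relu a = max a 0"

text \<open>The parameters \<open>(Q, K, V)\<close> of one head; a layer with \<open>M\<close> heads is a list of length \<open>M\<close>.\<close>

type_synonym attn_head = "real mat \<times> real mat \<times> real mat"

definition attention_params :: "nat \<Rightarrow> attn_head list \<Rightarrow> bool" where
  "attention_params D P \<longleftrightarrow>
     (\<forall>(Q, K, V) \<in> set P. Q \<in> carrier_mat D D \<and> K \<in> carrier_mat D D \<and> V \<in> carrier_mat D D)"

text \<open>The defining equation of the columns of the output, written for row \<open>r\<close> of column \<open>i\<close>.\<close>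

definition attention_layer :: "attn_head list \<Rightarrow> real mat \<Rightarrow> real mat" where
  "attention_layer P H = mat (dim_row H) (dim_col H) (\<lambda>(r, i).
     H $$ (r, i) +
     (\<Sum>(Q, K, V)\<leftarrow>P. 1 / real (dim_col H) *
        (\<Sum>j<dim_col H.
           relu ((Q *\<^sub>v col H i) \<bullet> (K *\<^sub>v col H j)) * (V *\<^sub>v col H j) $ r)))"

definition double_layer_block :: "attn_head list \<Rightarrow> attn_head list \<Rightarrow> real mat \<Rightarrow> real mat" where
  "double_layer_block P1 P2 H = attention_layer P2 (attention_layer P1 H)"

definition stack_cols :: "real mat \<Rightarrow> real vec" where
  "stack_cols A = vec_of_list (concat (map list_of_vec (cols A)))"

definition embed_dim :: "nat \<Rightarrow> nat \<Rightarrow> nat" where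
  "embed_dim q p = q * p + 3 * p + q + 3"

definition embed_col ::
  "nat \<Rightarrow> (nat \<Rightarrow> real vec) \<Rightarrow> (nat \<Rightarrow> real vec) \<Rightarrow> (nat \<Rightarrow> real) \<Rightarrow>
   real mat \<Rightarrow> real vec \<Rightarrow> (nat \<Rightarrow> real vec) \<Rightarrow> nat \<Rightarrow> real vec" where
  "embed_col n z x y \<Theta> \<beta> xhat i =
     z i @\<^sub>v x i @\<^sub>v vec_of_list [if i < n then y i else 0] @\<^sub>v
     stack_cols \<Theta> @\<^sub>v \<beta> @\<^sub>v xhat i @\<^sub>v vec_of_list [1, if i < n then 1 else 0]"

definition embedding ::
  "nat \<Rightarrow> nat \<Rightarrow> nat \<Rightarrow> (nat \<Rightarrow> real vec) \<Rightarrow> (nat \<Rightarrow> real vec) \<Rightarrow> (nat \<Rightarrow> real) \<Rightarrow>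
   real mat \<Rightarrow> real vec \<Rightarrow> (nat \<Rightarrow> real vec) \<Rightarrow> real mat" where
  "embedding n q p z x y \<Theta> \<beta> xhat =
     mat_of_cols (embed_dim q p) (map (embed_col n z x y \<Theta> \<beta> xhat) [0..<n + 1])"

text \<open>The blocks of a column fill its \<open>embed_dim q p\<close> rows exactly.\<close>

lemma dim_stack_cols:
  assumes "A \<in> carrier_mat q p"
  shows "dim_vec (stack_cols A) = q * p"
proof -
  have dims: "length (list_of_vec v) = q" if "v \<in> set (cols A)" for v
    using that assms cols_dim[of A] by (metis carrier_matD(1) carrier_vecD length_list_of_vec subsetD)
  have "dim_vec (stack_cols A) = (\<Sum>v\<leftarrow>cols A. length (list_of_vec v))"
    by (simp add: stack_cols_def length_concat comp_def)
  also have "\<dots> = (\<Sum>v\<leftarrow>cols A. q)"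
    using dims by (intro arg_cong[of _ _ sum_list] map_cong refl)
  also have "\<dots> = q * p"
    using assms by (simp add: sum_list_triv)
  finally show ?thesis .
qed

lemma embed_col_carrier:
  assumes "z i \<in> carrier_vec q" "x i \<in> carrier_vec p" "\<Theta> \<in> carrier_mat q p"
    and "\<beta> \<in> carrier_vec p" "xhat i \<in> carrier_vec p"
  shows "embed_col n z x y \<Theta> \<beta> xhat i \<in> carrier_vec (embed_dim q p)"
proof (rule carrier_vecI)
  show "dim_vec (embed_col n z x y \<Theta> \<beta> xhat i) = embed_dim q p"
    unfolding embed_col_def embed_dim_def index_append_vec(2) dim_stack_cols[OF assms(3)]
      assms(1,2,4,5)[THEN carrier_vecD] dim_vec_of_list
    by simp
qed

end

(*
  Every score has the form <h_i, A h_j> with Q = 1 and A a sparse matrix, and two heads with opposite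
  scores and opposite values produce the linear term s = relu s - relu (-s).

  The first layer uses the scores s_k = <Theta_k, z_i> - xhat_ik, which do not depend on j, together
  with the value 1: the average over j adds s_k to xhat_ik and so replaces it by <Theta_k, z_i>.

  The second layer adds multiples of sum_j (xhat_jk - x_jk) z_j to Theta_k and of
  sum_j (<beta, xhat_j> - y_j) xhat_j to beta, where j must not run over the query. The last two rows
  of column j give -b (1 - t_j) with t_j = 1 on samples and t_j = 0 on the query; adding this to both
  relu arguments changes nothing on the samples and kills the query as soon as b is at least the
  absolute value of the score of the query. Hence b, and with it the parameters, depends on the input.
*)

theory Submission
  imports Defs
begin

section \<open>Names and positions of the rows\<close>

text \<open>
  Names for the rows of an embedded column, block by block: \<open>Thr a k\<close> and \<open>Xhr k\<close> carry
  \<open>\<Theta>\<^sub>a\<^sub>k\<close> and the \<open>k\<close>-th coordinate of \<open>xhat\<close>, and \<open>One\<close>, \<open>Lab\<close> are the last two rows.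
\<close>

datatype row = Zr nat | Xr nat | Yr | Thr nat nat | Br nat | Xhr nat | One | Lab

text \<open>An entry \<open>(s, t, a)\<close> stands for \<open>a\<close> times the matrix unit in row \<open>s\<close> and column \<open>t\<close>.\<close>

type_synonym entries = "(row \<times> row \<times> real) list"

text \<open>The blocks follow the order of \<open>embed_col\<close>, and \<open>k * q + a\<close> is
  the column-major position produced by \<open>stack_cols\<close>.\<close>

fun row_pos :: "nat \<Rightarrow> nat \<Rightarrow> row \<Rightarrow> nat" where
  "row_pos q p (Zr a) = a"
| "row_pos q p (Xr k) = q + k"
| "row_pos q p Yr = q + p"
| "row_pos q p (Thr a k) = q + p + 1 + (k * q + a)"
| "row_pos q p (Br k) = q + p + 1 + q * p + k"
| "row_pos q p (Xhr k) = q + p + 1 + q * p + p + k"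
| "row_pos q p One = q + p + 1 + q * p + p + p"
| "row_pos q p Lab = q + p + 1 + q * p + p + p + 1"

text \<open>Names carry unbounded indices; one out of range would share its position with another
  name or leave the column.\<close>

fun valid_row :: "nat \<Rightarrow> nat \<Rightarrow> row \<Rightarrow> bool" where
  "valid_row q p (Zr a) = (a < q)"
| "valid_row q p (Xr k) = (k < p)"
| "valid_row q p Yr = True"
| "valid_row q p (Thr a k) = (a < q \<and> k < p)"
| "valid_row q p (Br k) = (k < p)"
| "valid_row q p (Xhr k) = (k < p)"
| "valid_row q p One = True"
| "valid_row q p Lab = True"

lemma column_major_less:
  fixes a k q p :: nat
  assumes "a < q" "k < p"
  shows "k * q + a < q * p"
proof -
  have "k * q + a < Suc k * q" using assms by simp
  also have "\<dots> \<le> p * q" using assms by (intro mult_le_mono1) simp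
  finally show ?thesis by (simp add: mult.commute)
qed

lemma row_pos_less: "valid_row q p s \<Longrightarrow> row_pos q p s < embed_dim q p"
  \<comment> \<open>The case expressions extract the indices of \<open>Thr\<close> ahead of the case
    split, so that the one nonlinear bound is at hand; the other blocks are linear
    arithmetic.\<close>
  using column_major_less[of "case s of Thr a k \<Rightarrow> a" q "case s of Thr a k \<Rightarrow> k" p]
  by (cases s) (simp_all add: embed_dim_def)

lemma column_major_inj:
  fixes a k q :: nat
  assumes "k * q + a = k' * q + a'" "a < q" "a' < q"
  shows "k = k' \<and> a = a'"
proof -
  have "(k * q + a) div q = k" "(k' * q + a') div q = k'" "(k * q + a) mod q = a" "(k' * q + a') mod q = a'"
    using assms(2,3) by simp_all
  then show ?thesis using assms(1) by metis
qed

text \<open>The blocks occupy disjoint intervals, so only two names in the block of Theta need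
  division with remainder; elsewhere comparing bounds suffices.\<close>

lemma row_pos_inj:
  assumes "valid_row q p s" "valid_row q p t"
  shows "row_pos q p s = row_pos q p t \<longleftrightarrow> s = t"
proof
  assume eq: "row_pos q p s = row_pos q p t"
  show "s = t"
  proof (cases "\<exists>a k a' k'. s = Thr a k \<and> t = Thr a' k'")
    case True
    then obtain a k a' k' where st: "s = Thr a k" "t = Thr a' k'" by blast
    then have "k * q + a = k' * q + a'" "a < q" "a' < q" using eq assms by simp_all
    from column_major_inj[OF this] show ?thesis using st by simp
  next
    case False
    have "k * q + a < q * p" if "s = Thr a k \<or> t = Thr a k" for a k
      using assms that column_major_less by auto
    then show ?thesis using eq assms False by (cases s; cases t) simp_all
  qed
qed simp

text \<open>The intervals of the blocks exhaust the column, and quotient and remainder by q decode a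
  position in the block of Theta.\<close>

lemma row_pos_surj:
  assumes "r < embed_dim q p"
  obtains s where "valid_row q p s" "r = row_pos q p s"
proof -
  let ?t = "r - (q + p + 1)"
  consider "r < q" | "q \<le> r" "r < q + p" | "r = q + p"
    | "q + p < r" "r < q + p + 1 + q * p"
    | "q + p + 1 + q * p \<le> r" "r < q + p + 1 + q * p + p"
    | "q + p + 1 + q * p + p \<le> r" "r < q + p + 1 + q * p + p + p"
    | "r = q + p + 1 + q * p + p + p" | "r = q + p + 1 + q * p + p + p + 1"
    using assms unfolding embed_dim_def by linarith
  then show thesis
  proof cases
    case 1 then show ?thesis using that[of "Zr r"] by simp
  next
    case 2 then show ?thesis using that[of "Xr (r - q)"] by simp
  next
    case 3 then show ?thesis using that[of Yr] by simp
  next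
    case 4
    then have t: "?t < q * p" by simp
    \<comment> \<open>A nonempty block of Theta forces q > 0, hence a remainder below q.\<close>
    then have "q > 0" by (cases q) auto
    moreover have "?t div q < p" using t by (simp add: less_mult_imp_div_less mult.commute)
    moreover have "r = q + p + 1 + ?t" using 4 by simp
    ultimately show ?thesis using that[of "Thr (?t mod q) (?t div q)"] by simp
  next
    case 5 then show ?thesis using that[of "Br (r - (q + p + 1 + q * p))"] by simp
  next
    case 6 then show ?thesis using that[of "Xhr (r - (q + p + 1 + q * p + p))"] by simp
  next
    case 7 then show ?thesis using that[of One] by simp
  next
    case 8 then show ?thesis using that[of Lab] by simp
  qed
qed

section \<open>Entries of an embedded column\<close>

fun entry ::
  "nat \<Rightarrow> (nat \<Rightarrow> real vec) \<Rightarrow> (nat \<Rightarrow> real vec) \<Rightarrow> (nat \<Rightarrow> real) \<Rightarrow>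
   real mat \<Rightarrow> real vec \<Rightarrow> (nat \<Rightarrow> real vec) \<Rightarrow> row \<Rightarrow> nat \<Rightarrow> real" where
  "entry n z x y \<Theta> \<beta> xhat (Zr a) i = z i $ a"
| "entry n z x y \<Theta> \<beta> xhat (Xr k) i = x i $ k"
| "entry n z x y \<Theta> \<beta> xhat Yr i = (if i < n then y i else 0)"
| "entry n z x y \<Theta> \<beta> xhat (Thr a k) i = \<Theta> $$ (a, k)"
| "entry n z x y \<Theta> \<beta> xhat (Br k) i = \<beta> $ k"
| "entry n z x y \<Theta> \<beta> xhat (Xhr k) i = xhat i $ k"
| "entry n z x y \<Theta> \<beta> xhat One i = 1"
| "entry n z x y \<Theta> \<beta> xhat Lab i = (if i < n then 1 else 0)"

lemma nth_concat_uniform: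
  assumes "\<And>xs. xs \<in> set xss \<Longrightarrow> length xs = m" "k < length xss" "a < m"
  shows "concat xss ! (k * m + a) = xss ! k ! a"
  using assms
proof (induction xss arbitrary: k)
  case Nil then show ?case by simp
next
  case (Cons xs xss)
  show ?case
    using Cons by (cases k) (auto simp: nth_append)
qed

lemma stack_cols_index:
  assumes "A \<in> carrier_mat q p" "a < q" "k < p"
  shows "stack_cols A $ (k * q + a) = A $$ (a, k)"
proof -
  have *: "k * q + a < length (concat (map list_of_vec (cols A)))"
    using dim_stack_cols[OF assms(1)] column_major_less[OF assms(2,3)]
    by (simp add: stack_cols_def)
  have "concat (map list_of_vec (cols A)) ! (k * q + a) = map list_of_vec (cols A) ! k ! a"
    using assms by (intro nth_concat_uniform) (auto simp: cols_def)
  also have "\<dots> = A $$ (a, k)" using assms by (simp add: list_of_vec_index)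
  finally show ?thesis
    unfolding stack_cols_def by (simp add: vec_of_list_index)
qed

lemma embed_col_index:
  assumes "z i \<in> carrier_vec q" "x i \<in> carrier_vec p" "\<Theta> \<in> carrier_mat q p"
    and "\<beta> \<in> carrier_vec p" "xhat i \<in> carrier_vec p" "valid_row q p s"
  shows "embed_col n z x y \<Theta> \<beta> xhat i $ row_pos q p s = entry n z x y \<Theta> \<beta> xhat s i"
proof -
  note d = dim_stack_cols[OF assms(3)] assms(1,2,4,5)[THEN carrier_vecD]
  note simps = append_vec_def Let_def d embed_col_def embed_dim_def
  show ?thesis
  proof (cases s)
    case (Thr a k)
    then have "k * q + a < q * p" "stack_cols \<Theta> $ (k * q + a) = \<Theta> $$ (a, k)"
      using assms(6) by (auto simp: column_major_less stack_cols_index[OF assms(3)])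
    then show ?thesis using Thr by (simp add: simps del: vec_of_list_Cons)
  \<comment> \<open>Deleting \<open>vec_of_list_Cons\<close> keeps the short lists intact, so that
    \<open>vec_of_list_index\<close> reads their entries.\<close>
  qed (use assms(6) in \<open>auto simp: simps vec_of_list_index simp del: vec_of_list_Cons\<close>)
qed

lemma embedding_carrier: "embedding n q p z x y \<Theta> \<beta> xhat \<in> carrier_mat (embed_dim q p) (n + 1)"
  unfolding embedding_def by (simp add: carrier_matI)

section \<open>Sparse matrices and their bilinear forms\<close>

text \<open>Summing over the list instead of overwriting makes the matrix additive: appending lists
  adds matrices.\<close>

definition sparse :: "nat \<Rightarrow> nat \<Rightarrow> entries \<Rightarrow> real mat" where
  "sparse q p T = mat (embed_dim q p) (embed_dim q p) (\<lambda>(r, c).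
     \<Sum>(s, t, a)\<leftarrow>T. if r = row_pos q p s \<and> c = row_pos q p t then a else 0)"

definition valid_entries :: "nat \<Rightarrow> nat \<Rightarrow> entries \<Rightarrow> bool" where
  "valid_entries q p T \<longleftrightarrow> (\<forall>(s, t, a) \<in> set T. valid_row q p s \<and> valid_row q p t)"

lemma sparse_carrier: "sparse q p T \<in> carrier_mat (embed_dim q p) (embed_dim q p)"
  by (simp add: sparse_def)

lemma sparse_mult_vec:
  assumes "valid_entries q p T" "v \<in> carrier_vec (embed_dim q p)" "r < embed_dim q p"
  shows "(sparse q p T *\<^sub>v v) $ r =
    (\<Sum>(s, t, a)\<leftarrow>T. if r = row_pos q p s then a * v $ row_pos q p t else 0)"
proof -
  have "(sparse q p T *\<^sub>v v) $ r = (\<Sum>c<embed_dim q p.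
      (\<Sum>(s, t, a)\<leftarrow>T. if r = row_pos q p s \<and> c = row_pos q p t then a else 0) * v $ c)"
    using assms(2,3) by (simp add: sparse_def scalar_prod_def lessThan_atLeast0)
  also have "\<dots> = (\<Sum>(s, t, a)\<leftarrow>T. if r = row_pos q p s then a * v $ row_pos q p t else 0)"
    using assms(1)
  proof (induction T)
    case Nil then show ?case by simp
  next
    case (Cons e T)
    obtain s t a where e: "e = (s, t, a)" by (cases e)
    have t: "row_pos q p t < embed_dim q p"
      using Cons.prems by (auto simp: e valid_entries_def row_pos_less)
    \<comment> \<open>With the condition on \<open>c\<close> outermost, the sum over
      \<open>c\<close> collapses to one term.\<close>
    have "(\<Sum>c<embed_dim q p. (if r = row_pos q p s \<and> c = row_pos q p t then a else 0) * v $ c) =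
      (\<Sum>c<embed_dim q p. if c = row_pos q p t then (if r = row_pos q p s then a * v $ c else 0) else 0)"
      by (intro sum.cong) auto
    then show ?case
      using Cons t by (simp add: e valid_entries_def distrib_right sum.distrib)
  qed
  finally show ?thesis .
qed

text \<open>This is the form of a score: an entry \<open>(s, t, a)\<close> multiplies row
  \<open>s\<close> of the attending column by row \<open>t\<close> of the attended one.\<close>

lemma sparse_bilinear:
  assumes "valid_entries q p T" "u \<in> carrier_vec (embed_dim q p)" "v \<in> carrier_vec (embed_dim q p)"
  shows "u \<bullet> (sparse q p T *\<^sub>v v) = (\<Sum>(s, t, a)\<leftarrow>T. a * u $ row_pos q p s * v $ row_pos q p t)"
proof -
  have "u \<bullet> (sparse q p T *\<^sub>v v) = (\<Sum>r<embed_dim q p. u $ r * (sparse q p T *\<^sub>v v) $ r)"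
    by (simp add: sparse_def scalar_prod_def[of u] lessThan_atLeast0)
  also have "\<dots> = (\<Sum>r<embed_dim q p. u $ r *
      (\<Sum>(s, t, a)\<leftarrow>T. if r = row_pos q p s then a * v $ row_pos q p t else 0))"
    using assms by (intro sum.cong) (auto simp: sparse_mult_vec)
  also have "\<dots> = (\<Sum>(s, t, a)\<leftarrow>T. a * u $ row_pos q p s * v $ row_pos q p t)"
    using assms(1)
  proof (induction T)
    case Nil then show ?case by simp
  next
    case (Cons e T)
    obtain s t a where e: "e = (s, t, a)" by (cases e)
    have s: "row_pos q p s < embed_dim q p"
      using Cons.prems by (auto simp: e valid_entries_def row_pos_less)
    have "(\<Sum>r<embed_dim q p. u $ r * (if r = row_pos q p s then a * v $ row_pos q p t else 0)) =
      (\<Sum>r<embed_dim q p. if r = row_pos q p s then a * u $ r * v $ row_pos q p t else 0)"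
      by (intro sum.cong) auto
    then show ?case
      using Cons s by (simp add: e valid_entries_def distrib_left sum.distrib)
  qed
  finally show ?thesis .
qed

section \<open>Pairs of opposite heads with a mask on the query\<close>

definition neg_entries :: "entries \<Rightarrow> entries" where
  "neg_entries T = map (\<lambda>(s, t, a). (s, t, - a)) T"

text \<open>Both entries read row \<open>One\<close> of the attending column, which is 1 on samples
  and query alike, so the mask depends on the attended column only.\<close>

definition query_mask :: "real \<Rightarrow> entries" where
  "query_mask b = [(One, One, - b), (One, Lab, b)]"

text \<open>The query matrix is the identity, so the key matrix carries the whole bilinear form. The
  mask is appended after negation, because both relu arguments have to be lowered by the same
  amount.\<close>

definition head_pair ::
  "nat \<Rightarrow> nat \<Rightarrow> real \<times> entries \<times> entries \<Rightarrow> attn_head list" where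
  "head_pair q p = (\<lambda>(b, T, W).
     [(1\<^sub>m (embed_dim q p), sparse q p (T @ query_mask b), sparse q p W),
      (1\<^sub>m (embed_dim q p), sparse q p (neg_entries T @ query_mask b), sparse q p (neg_entries W))])"

text \<open>For b >= 0 this is soft thresholding: zero on [-b, b], and the identity for b =
  0.\<close>

definition gate :: "real \<Rightarrow> real \<Rightarrow> real" where
  "gate b s = relu (s - b) - relu (- s - b)"

lemma gate_0: "gate 0 s = s"
  by (simp add: gate_def relu_def max_def)

lemma gate_eq_0: "\<bar>s\<bar> \<le> b \<Longrightarrow> gate b s = 0"
  by (auto simp: gate_def relu_def max_def)

lemma sum_list_neg_entries:
  "(\<Sum>(s, t, a)\<leftarrow>neg_entries T. a * f s * g t) = - (\<Sum>(s, t, a)\<leftarrow>T. a * f s * (g t :: real))"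
  "(\<Sum>(s, t, a)\<leftarrow>neg_entries T. if P s then a * g t else 0) =
     - (\<Sum>(s, t, a)\<leftarrow>T. if P s then a * g t else 0)"
  by (induction T) (auto simp: neg_entries_def)

lemma valid_neg_entries: "valid_entries q p (neg_entries T) = valid_entries q p T"
  by (induction T) (auto simp: neg_entries_def valid_entries_def)

lemma valid_append_query_mask: "valid_entries q p (T @ query_mask b) = valid_entries q p T"
  by (simp add: valid_entries_def query_mask_def ball_Un)

lemma attention_params_head_pairs:
  "attention_params (embed_dim q p) (concat (map (head_pair q p) G))"
  by (auto simp: attention_params_def head_pair_def sparse_carrier)

lemma length_head_pairs: "length (concat (map (head_pair q p) G)) = 2 * length G"
  by (induction G) (auto simp: head_pair_def)

section \<open>Action of a layer on an embedding\<close>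

text \<open>Serves for the input, for the embedding between the layers and for the output of a
  layer; the bounds i <= n include the query.\<close>

locale embedded_input =
  fixes n q p :: nat
    and z x :: "nat \<Rightarrow> real vec" and y :: "nat \<Rightarrow> real"
    and \<Theta> :: "real mat" and \<beta> :: "real vec" and xhat :: "nat \<Rightarrow> real vec"
  assumes z: "\<And>i. i \<le> n \<Longrightarrow> z i \<in> carrier_vec q"
    and x: "\<And>i. i \<le> n \<Longrightarrow> x i \<in> carrier_vec p"
    and \<Theta>: "\<Theta> \<in> carrier_mat q p"
    and \<beta>: "\<beta> \<in> carrier_vec p"
    and xhat: "\<And>i. i \<le> n \<Longrightarrow> xhat i \<in> carrier_vec p"
begin

abbreviation "H \<equiv> embedding n q p z x y \<Theta> \<beta> xhat"
abbreviation "E \<equiv> entry n z x y \<Theta> \<beta> xhat"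

lemma col_carrier: "i \<le> n \<Longrightarrow> col H i \<in> carrier_vec (embed_dim q p)"
  using embedding_carrier[of n q p z x y \<Theta> \<beta> xhat] by (simp add: carrier_vecI)

lemma index: "i \<le> n \<Longrightarrow> valid_row q p s \<Longrightarrow> H $$ (row_pos q p s, i) = E s i"
  unfolding embedding_def
  by (simp add: mat_of_cols_index row_pos_less embed_col_index[OF z x \<Theta> \<beta> xhat] del: upt_Suc)

lemma col_index: "i \<le> n \<Longrightarrow> valid_row q p s \<Longrightarrow> col H i $ row_pos q p s = E s i"
  using embedding_carrier[of n q p z x y \<Theta> \<beta> xhat] by (simp add: index row_pos_less)

lemma score:
  assumes "valid_entries q p T" "i \<le> n" "j \<le> n"
  shows "col H i \<bullet> (sparse q p T *\<^sub>v col H j) = (\<Sum>(s, t, a)\<leftarrow>T. a * E s i * E t j)"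
proof -
  have "col H i \<bullet> (sparse q p T *\<^sub>v col H j) =
    (\<Sum>(s, t, a)\<leftarrow>T. a * col H i $ row_pos q p s * col H j $ row_pos q p t)"
    using assms by (intro sparse_bilinear col_carrier)
  also have "\<dots> = (\<Sum>(s, t, a)\<leftarrow>T. a * E s i * E t j)"
    using assms by (intro arg_cong[of _ _ sum_list] map_cong) (auto simp: valid_entries_def col_index)
  finally show ?thesis .
qed

text \<open>Distinct valid names have distinct positions, so the output row can be tested by
  name.\<close>

lemma val:
  assumes "valid_entries q p W" "j \<le> n" "valid_row q p s"
  shows "(sparse q p W *\<^sub>v col H j) $ row_pos q p s = (\<Sum>(s', t, a)\<leftarrow>W. if s = s' then a * E t j else 0)"
proof -
  have "(sparse q p W *\<^sub>v col H j) $ row_pos q p s =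
    (\<Sum>(s', t, a)\<leftarrow>W. if row_pos q p s = row_pos q p s' then a * col H j $ row_pos q p t else 0)"
    using assms by (intro sparse_mult_vec col_carrier row_pos_less)
  also have "\<dots> = (\<Sum>(s', t, a)\<leftarrow>W. if s = s' then a * E t j else 0)"
    using assms by (intro arg_cong[of _ _ sum_list] map_cong)
      (auto simp: valid_entries_def col_index row_pos_inj)
  finally show ?thesis .
qed

text \<open>The threshold b at j = n and 0 elsewhere is the effect of \<open>query_mask\<close> once
  the two heads are combined.\<close>

definition pair_output :: "row \<Rightarrow> nat \<Rightarrow> real \<times> entries \<times> entries \<Rightarrow> real" where
  "pair_output s i = (\<lambda>(b, T, W). 1 / real (n + 1) * (\<Sum>j<n + 1.
     gate (if j < n then 0 else b) (\<Sum>(s, t, a)\<leftarrow>T. a * E s i * E t j) *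
     (\<Sum>(s', t, a)\<leftarrow>W. if s = s' then a * E t j else 0)))"

lemma head_pair_output:
  assumes "valid_entries q p T" "valid_entries q p W" "i \<le> n" "valid_row q p s"
  shows "(\<Sum>(Q, K, V)\<leftarrow>head_pair q p (b, T, W). 1 / real (n + 1) *
      (\<Sum>j<n + 1. relu ((Q *\<^sub>v col H i) \<bullet> (K *\<^sub>v col H j)) * (V *\<^sub>v col H j) $ row_pos q p s)) =
    pair_output s i (b, T, W)"
proof -
  have v: "valid_entries q p (T @ query_mask b)" "valid_entries q p (neg_entries T @ query_mask b)"
    using assms(1) by (simp_all add: valid_append_query_mask valid_neg_entries)
  \<comment> \<open>\<open>S\<close> is the unmasked score and \<open>w\<close> the value; the mask
    contributes \<open>- m j\<close>. The two heads give relu (S - m) w and relu (- S - m) (- w),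
    which add up to \<open>gate m S * w\<close>.\<close>
  define S w m where "S j = (\<Sum>(s, t, a)\<leftarrow>T. a * E s i * E t j)"
    and "w j = (\<Sum>(s', t, a)\<leftarrow>W. if s = s' then a * E t j else 0)"
    and "m j = (if j < n then 0 else b)" for j
  have scores: "col H i \<bullet> (sparse q p (T @ query_mask b) *\<^sub>v col H j) = S j - m j"
    "col H i \<bullet> (sparse q p (neg_entries T @ query_mask b) *\<^sub>v col H j) = - S j - m j" if "j \<le> n" for j
    using v that assms(3) by (simp_all add: score sum_list_neg_entries query_mask_def S_def m_def)
  have vals: "(sparse q p W *\<^sub>v col H j) $ row_pos q p s = w j"
    "(sparse q p (neg_entries W) *\<^sub>v col H j) $ row_pos q p s = - w j" if "j \<le> n" for j
    using that assms(2,4) by (simp_all add: val sum_list_neg_entries valid_neg_entries w_def)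
  have "(\<Sum>j<n + 1. relu (S j - m j) * w j) + (\<Sum>j<n + 1. relu (- S j - m j) * - w j) =
    (\<Sum>j<n + 1. gate (m j) (S j) * w j)"
    unfolding sum.distrib[symmetric] by (intro sum.cong) (simp_all add: gate_def left_diff_distrib)
  moreover have "(\<Sum>j<n + 1. relu (col H i \<bullet> (sparse q p (T @ query_mask b) *\<^sub>v col H j)) *
      (sparse q p W *\<^sub>v col H j) $ row_pos q p s) = (\<Sum>j<n + 1. relu (S j - m j) * w j)"
    by (intro sum.cong) (simp_all add: scores vals)
  moreover have "(\<Sum>j<n + 1. relu (col H i \<bullet> (sparse q p (neg_entries T @ query_mask b) *\<^sub>v col H j)) *
      (sparse q p (neg_entries W) *\<^sub>v col H j) $ row_pos q p s) = (\<Sum>j<n + 1. relu (- S j - m j) * - w j)"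
    by (intro sum.cong) (simp_all add: scores vals)
  ultimately show ?thesis
    unfolding pair_output_def prod.case S_def[symmetric] w_def[symmetric] m_def[symmetric]
    \<comment> \<open>The sums over \<open>j < n + 1\<close> must stay unsplit to match the
      equations above, hence the deleted rules.\<close>
    by (simp add: head_pair_def one_mult_mat_vec[OF col_carrier[OF assms(3)]] add_divide_distrib[symmetric]
      del: sum.lessThan_Suc of_nat_Suc)
qed

lemma layer_output:
  assumes "\<And>b T W. (b, T, W) \<in> set G \<Longrightarrow> valid_entries q p T \<and> valid_entries q p W"
    and "i \<le> n" "valid_row q p s"
  shows "attention_layer (concat (map (head_pair q p) G)) H $$ (row_pos q p s, i) =
    E s i + (\<Sum>g\<leftarrow>G. pair_output s i g)"
proof -
  define F where "F = (\<lambda>(Q, K, V). 1 / real (n + 1) *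
    (\<Sum>j<n + 1. relu ((Q *\<^sub>v col H i) \<bullet> (K *\<^sub>v col H j)) * (V *\<^sub>v col H j) $ row_pos q p s))"
  have dims: "dim_row H = embed_dim q p" "dim_col H = n + 1"
    using embedding_carrier[of n q p z x y \<Theta> \<beta> xhat] by auto
  have "attention_layer (concat (map (head_pair q p) G)) H $$ (row_pos q p s, i) =
    E s i + (\<Sum>h\<leftarrow>concat (map (head_pair q p) G). F h)"
    unfolding attention_layer_def F_def using assms(2,3)
    by (simp add: dims row_pos_less index del: sum.lessThan_Suc of_nat_Suc)
  also have "(\<Sum>h\<leftarrow>concat (map (head_pair q p) G). F h) = (\<Sum>g\<leftarrow>G. \<Sum>h\<leftarrow>head_pair q p g. F h)"
    by (induction G) auto
  also have "\<dots> = (\<Sum>g\<leftarrow>G. pair_output s i g)"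
    using assms head_pair_output[of _ _ i s] unfolding F_def
    by (intro arg_cong[of _ _ sum_list] map_cong) fastforce+
  finally show ?thesis .
qed

text \<open>Every row index is the position of a valid name by \<open>row_pos_surj\<close>, so it is
  enough to compare entries by name.\<close>

lemma layer_eqI:
  assumes "embedded_input n q p z x \<Theta>' \<beta>' xhat'"
    and "\<And>b T W. (b, T, W) \<in> set G \<Longrightarrow> valid_entries q p T \<and> valid_entries q p W"
    and "\<And>i s. i \<le> n \<Longrightarrow> valid_row q p s \<Longrightarrow>
      entry n z x y \<Theta>' \<beta>' xhat' s i = E s i + (\<Sum>g\<leftarrow>G. pair_output s i g)"
  shows "attention_layer (concat (map (head_pair q p) G)) H = embedding n q p z x y \<Theta>' \<beta>' xhat'"
proof (rule eq_matI)
  interpret new: embedded_input n q p z x y \<Theta>' \<beta>' xhat' by fact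
  note carriers = embedding_carrier[of n q p z x y \<Theta> \<beta> xhat] embedding_carrier[of n q p z x y \<Theta>' \<beta>' xhat']
  show "dim_row (attention_layer (concat (map (head_pair q p) G)) H) = dim_row (embedding n q p z x y \<Theta>' \<beta>' xhat')"
    "dim_col (attention_layer (concat (map (head_pair q p) G)) H) = dim_col (embedding n q p z x y \<Theta>' \<beta>' xhat')"
    using carriers by (auto simp: attention_layer_def)
  fix r i assume "r < dim_row (embedding n q p z x y \<Theta>' \<beta>' xhat')"
    "i < dim_col (embedding n q p z x y \<Theta>' \<beta>' xhat')"
  then have r: "r < embed_dim q p" and i: "i \<le> n" using carriers by auto
  from r obtain s where s: "valid_row q p s" "r = row_pos q p s" by (rule row_pos_surj)
  show "attention_layer (concat (map (head_pair q p) G)) H $$ (r, i) =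
      embedding n q p z x y \<Theta>' \<beta>' xhat' $$ (r, i)"
    using layer_output[OF assms(2) i s(1)] assms(3)[OF i s(1)] new.index[OF i s(1)] s(2) by simp
qed

end

section \<open>The two layers\<close>

lemma sum_list_upt: "(\<Sum>k\<leftarrow>[0..<m]. f k) = (\<Sum>k<m. f k)"
  by (simp add: interv_sum_list_conv_sum_set_nat lessThan_atLeast0)

text \<open>\<open>Zr a\<close> and \<open>Xhr k\<close> are read at the attending column;
  \<open>Thr a k\<close> and \<open>One\<close> are read at the attended one, where they are the
  same for all columns. The mask is 0, since the query takes part in the average.\<close>

definition layer1 ::
  "nat \<Rightarrow> nat \<Rightarrow> (real \<times> entries \<times> entries) list" where
  "layer1 q p = map (\<lambda>k. (0, (Xhr k, One, - 1) # map (\<lambda>a. (Zr a, Thr a k, 1)) [0..<q],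
     [(Xhr k, One, 1)])) [0..<p]"

text \<open>The first pair writes all of beta, since its score is the same residual for every
  coordinate; Theta needs one pair per column. The factor n + 1 in the values cancels the
  averaging.\<close>

definition layer2 ::
  "nat \<Rightarrow> nat \<Rightarrow> nat \<Rightarrow> real \<Rightarrow> real \<Rightarrow> real \<Rightarrow>
   (real \<times> entries \<times> entries) list" where
  "layer2 n q p \<alpha> \<eta> b =
     (b, (One, Yr, - 1) # map (\<lambda>k. (Br k, Xhr k, 1)) [0..<p],
        map (\<lambda>k. (Br k, Xhr k, - \<alpha> * real (n + 1))) [0..<p]) #
     map (\<lambda>k. (b, [(One, Xhr k, 1), (One, Xr k, - 1)],
        map (\<lambda>a. (Thr a k, Zr a, - \<eta> * real (n + 1))) [0..<q])) [0..<p]"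

context embedded_input
begin

lemma layer1_output:
  assumes xhat': "\<And>i. i \<le> n \<Longrightarrow> xhat' i = \<Theta>\<^sup>T *\<^sub>v z i"
  shows "attention_layer (concat (map (head_pair q p) (layer1 q p))) H = embedding n q p z x y \<Theta> \<beta> xhat'"
proof (rule layer_eqI)
  show "embedded_input n q p z x \<Theta> \<beta> xhat'"
    using z x \<Theta> \<beta> by unfold_locales (auto simp: xhat')
  show "valid_entries q p T \<and> valid_entries q p W" if "(b, T, W) \<in> set (layer1 q p)" for b T W
    using that by (auto simp: layer1_def valid_entries_def)
  fix i s assume i: "i \<le> n" and s: "valid_row q p s"
  \<comment> \<open>The summands do not depend on j, so the average over all n + 1 columns returns
    the constant.\<close>
  have step: "1 / real (n + 1) * (\<Sum>j<n + 1. c * d) = c * d" for c d :: real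
    by simp
  have "(\<Sum>g\<leftarrow>layer1 q p. pair_output s i g) =
    (\<Sum>k<p. ((\<Sum>a<q. z i $ a * \<Theta> $$ (a, k)) - xhat i $ k) * (if s = Xhr k then 1 else 0))"
    unfolding layer1_def pair_output_def map_map sum_list_upt comp_def prod.case list.map sum_list.Cons sum_list.Nil
      entry.simps if_cancel gate_0 step by (auto intro!: sum.cong)
  also have "\<dots> = entry n z x y \<Theta> \<beta> xhat' s i - E s i"
    using s i z[OF i] \<Theta>
    by (cases s) (auto simp: xhat' scalar_prod_def lessThan_atLeast0 mult.commute if_distrib cong: if_cong)
  finally show "entry n z x y \<Theta> \<beta> xhat' s i = E s i + (\<Sum>g\<leftarrow>layer1 q p. pair_output s i g)"
    by simp
qed

text \<open>The bounds on \<open>b\<close> concern column n alone. Its row \<open>Yr\<close> holds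
  0, so the scores to be suppressed are <beta, xhat_n> and the coordinates of xhat_n - x_n.\<close>

lemma layer2_output:
  assumes \<Theta>': "\<Theta>' \<in> carrier_mat q p" "\<And>a k. a < q \<Longrightarrow> k < p \<Longrightarrow>
      \<Theta>' $$ (a, k) = \<Theta> $$ (a, k) - \<eta> * (\<Sum>j<n. (xhat j $ k - x j $ k) * z j $ a)"
    and \<beta>': "\<beta>' \<in> carrier_vec p" "\<And>k. k < p \<Longrightarrow>
      \<beta>' $ k = \<beta> $ k - \<alpha> * (\<Sum>j<n. ((\<Sum>k<p. \<beta> $ k * xhat j $ k) - y j) * xhat j $ k)"
    and b: "\<bar>\<Sum>k<p. \<beta> $ k * xhat n $ k\<bar> \<le> b" "\<And>k. k < p \<Longrightarrow> \<bar>xhat n $ k - x n $ k\<bar> \<le> b"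
  shows "attention_layer (concat (map (head_pair q p) (layer2 n q p \<alpha> \<eta> b))) H =
    embedding n q p z x y \<Theta>' \<beta>' xhat"
proof (rule layer_eqI)
  show "embedded_input n q p z x \<Theta>' \<beta>' xhat"
    using z x \<Theta>' \<beta>' xhat by unfold_locales auto
  show "valid_entries q p T \<and> valid_entries q p W" if "(b', T, W) \<in> set (layer2 n q p \<alpha> \<eta> b)" for b' T W
    using that by (auto simp: layer2_def valid_entries_def)
  fix i s assume i: "i \<le> n" and s: "valid_row q p s"
  define u where "u j = (\<Sum>k<p. \<beta> $ k * xhat j $ k) - (if j < n then y j else 0)" for j
  define v where "v k j = xhat j $ k - x j $ k" for k j
  \<comment> \<open>Threshold 0 leaves the samples as they are, and the term j = n is killed by its
    threshold \<open>b\<close>.\<close>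
  have masked: "1 / real (n + 1) * (\<Sum>j<n + 1. gate (if j < n then 0 else b) (c j) * d j) =
      1 / real (n + 1) * (\<Sum>j<n. c j * d j)" if "\<bar>c n\<bar> \<le> b" for c d :: "nat \<Rightarrow> real"
    using that by (simp add: gate_0 gate_eq_0)
  have beta: "pair_output s i (b, (One, Yr, - 1) # map (\<lambda>k. (Br k, Xhr k, 1)) [0..<p],
      map (\<lambda>k. (Br k, Xhr k, - \<alpha> * real (n + 1))) [0..<p]) =
    - \<alpha> * (\<Sum>j<n. u j * (\<Sum>k<p. if s = Br k then xhat j $ k else 0))"
  proof -
    have 1: "(\<Sum>(s, t, a)\<leftarrow>(One, Yr, - 1) # map (\<lambda>k. (Br k, Xhr k, 1)) [0..<p]. a * E s i * E t j) = u j" for j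
      by (simp add: comp_def sum_list_upt u_def)
    have 2: "(\<Sum>(s', t, a)\<leftarrow>map (\<lambda>k. (Br k, Xhr k, - \<alpha> * real (n + 1))) [0..<p]. if s = s' then a * E t j else 0) =
        real (n + 1) * (- \<alpha> * (\<Sum>k<p. if s = Br k then xhat j $ k else 0))" for j
      unfolding map_map comp_def prod.case sum_list_upt sum_distrib_left by (intro sum.cong) auto
    have "\<bar>u n\<bar> \<le> b" using b(1) by (simp add: u_def)
    then show ?thesis
      unfolding pair_output_def prod.case 1 2 by (subst masked) (simp_all add: sum_distrib_left mult.assoc mult.left_commute)
  qed
  have theta: "pair_output s i (b, [(One, Xhr k, 1), (One, Xr k, - 1)],
      map (\<lambda>a. (Thr a k, Zr a, - \<eta> * real (n + 1))) [0..<q]) =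
    - \<eta> * (\<Sum>j<n. v k j * (\<Sum>a<q. if s = Thr a k then z j $ a else 0))" if k: "k < p" for k
  proof -
    have 1: "(\<Sum>(s, t, a)\<leftarrow>[(One, Xhr k, 1), (One, Xr k, - 1)]. a * E s i * E t j) = v k j" for j
      by (simp add: v_def)
    have 2: "(\<Sum>(s', t, a)\<leftarrow>map (\<lambda>a. (Thr a k, Zr a, - \<eta> * real (n + 1))) [0..<q]. if s = s' then a * E t j else 0) =
        real (n + 1) * (- \<eta> * (\<Sum>a<q. if s = Thr a k then z j $ a else 0))" for j
      unfolding map_map comp_def prod.case sum_list_upt sum_distrib_left by (intro sum.cong) auto
    have "\<bar>v k n\<bar> \<le> b" using b(2)[OF k] by (simp add: v_def)
    then show ?thesis
      unfolding pair_output_def prod.case 1 2 by (subst masked) (simp_all add: sum_distrib_left mult.assoc mult.left_commute)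
  qed
  have "(\<Sum>g\<leftarrow>layer2 n q p \<alpha> \<eta> b. pair_output s i g) =
    - \<alpha> * (\<Sum>j<n. u j * (\<Sum>k<p. if s = Br k then xhat j $ k else 0)) +
    (\<Sum>k<p. - \<eta> * (\<Sum>j<n. v k j * (\<Sum>a<q. if s = Thr a k then z j $ a else 0)))"
    \<comment> \<open>\<open>theta\<close> requires k < p, so it is applied under the sum by
      congruence.\<close>
    by (simp only: layer2_def list.map sum_list.Cons beta map_map comp_def sum_list_upt)
      (intro arg_cong2[of _ _ _ _ "(+)"] sum.cong refl theta, simp)
  also have "\<dots> = entry n z x y \<Theta>' \<beta>' xhat s i - E s i"
  proof (cases s)
    case (Br k)
    then show ?thesis using s by (simp add: \<beta>' u_def)
  next
    case (Thr a k)
    \<comment> \<open>Only the pair of index \<open>k\<close> writes to column \<open>k\<close> of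
      Theta.\<close>
    have "(\<Sum>k'<p. - \<eta> * (\<Sum>j<n. v k' j * (\<Sum>a'<q. if s = Thr a' k' then z j $ a' else 0))) =
      (\<Sum>k'<p. if k' = k then - \<eta> * (\<Sum>j<n. v k j * z j $ a) else 0)"
      using s Thr by (intro sum.cong) auto
    then show ?thesis using s Thr by (simp add: \<Theta>' v_def)
  qed simp_all
  finally show "entry n z x y \<Theta>' \<beta>' xhat s i = E s i + (\<Sum>g\<leftarrow>layer2 n q p \<alpha> \<eta> b. pair_output s i g)"
    by simp
qed

end

section \<open>The least squares update as the output of the two layers\<close>

theorem theorem3p2:
  fixes n p q l :: nat and \<alpha> \<eta> :: real
    and z x :: "nat \<Rightarrow> real vec" and y :: "nat \<Rightarrow> real"
    and Z X :: "real mat" and Y :: "real vec"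
    and \<Theta> :: "nat \<Rightarrow> real mat" and \<beta> :: "nat \<Rightarrow> real vec"
    and xhat :: "nat \<Rightarrow> nat \<Rightarrow> real vec"
  assumes z: "\<And>i. i \<le> n \<Longrightarrow> z i \<in> carrier_vec q"
    and x: "\<And>i. i \<le> n \<Longrightarrow> x i \<in> carrier_vec p"
    and Z: "Z = mat_of_rows q (map z [0..<n])"
    and X: "X = mat_of_rows p (map x [0..<n])"
    and Y: "Y = vec n y"
    and \<Theta>: "\<Theta> l \<in> carrier_mat q p"
    and \<beta>: "\<beta> l \<in> carrier_vec p"
    and xhat: "\<And>i. i \<le> n \<Longrightarrow> xhat l i \<in> carrier_vec p"
    and \<Theta>_step: "\<Theta> (l + 1) = \<Theta> l - \<eta> \<cdot>\<^sub>m (Z\<^sup>T * (Z * \<Theta> l - X))"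
    and \<beta>_step: "\<beta> (l + 1) = \<beta> l - \<alpha> \<cdot>\<^sub>v ((\<Theta> l)\<^sup>T *\<^sub>v (Z\<^sup>T *\<^sub>v (Z *\<^sub>v (\<Theta> l *\<^sub>v \<beta> l) - Y)))"
    and xhat_step: "\<And>i. i \<le> n \<Longrightarrow> xhat (l + 1) i = (\<Theta> l)\<^sup>T *\<^sub>v z i"
  shows "\<exists>P1 P2. attention_params (embed_dim q p) P1 \<and> length P1 = 2 * p \<and>
           attention_params (embed_dim q p) P2 \<and> length P2 = 2 * (p + 1) \<and>
           double_layer_block P1 P2 (embedding n q p z x y (\<Theta> l) (\<beta> l) (xhat l)) =
             embedding n q p z x y (\<Theta> (l + 1)) (\<beta> (l + 1)) (xhat (l + 1))"
proof -
  \<comment> \<open>\<open>xh\<close> is the prediction at the old Theta, which the first layer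
    leaves in the rows \<open>Xhr\<close>; both gradients are expressed through it.\<close>
  define xh where "xh = xhat (l + 1)"
  have xh: "xh i = (\<Theta> l)\<^sup>T *\<^sub>v z i" if "i \<le> n" for i
    using xhat_step[OF that] by (simp add: xh_def)
  have Z_dim: "Z \<in> carrier_mat n q" and X_dim: "X \<in> carrier_mat n p" by (auto simp: Z X)
  have Z_row: "row Z j = z j" and Z_index: "a < q \<Longrightarrow> Z $$ (j, a) = z j $ a"
    and X_index: "k < p \<Longrightarrow> X $$ (j, k) = x j $ k" if "j < n" for j a k
    using that z[of j] by (simp_all add: Z X mat_of_rows_index)
  have xh_index: "xh j $ k = (\<Sum>a<q. \<Theta> l $$ (a, k) * z j $ a)" if "j \<le> n" "k < p" for j k
    using that z[of j] \<Theta> by (simp add: xh scalar_prod_def lessThan_atLeast0)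
  \<comment> \<open>The rows of \<open>Z * \<Theta> l\<close> are the \<open>xh j\<close>, which
    turns the first gradient into a sum over samples.\<close>
  have "(Z * \<Theta> l) $$ (j, k) = xh j $ k" if "j < n" "k < p" for j k
    using that \<Theta> Z_dim by (simp add: xh_index scalar_prod_def lessThan_atLeast0 Z_index mult.commute)
  then have \<Theta>': "\<Theta> (l + 1) $$ (a, k) = \<Theta> l $$ (a, k) - \<eta> * (\<Sum>j<n. (xh j $ k - x j $ k) * z j $ a)"
    if "a < q" "k < p" for a k
    using that \<Theta> Z_dim X_dim
    unfolding \<Theta>_step
    by (simp add: scalar_prod_def lessThan_atLeast0 Z_index X_index mult.commute)
  \<comment> \<open>Interchanging the sums over \<open>a\<close> and \<open>k\<close> moves Theta
    from beta to \<open>z j\<close>.\<close>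
  have pred: "(Z *\<^sub>v (\<Theta> l *\<^sub>v \<beta> l)) $ j = (\<Sum>k<p. \<beta> l $ k * xh j $ k)" if j: "j < n" for j
  proof -
    have "(Z *\<^sub>v (\<Theta> l *\<^sub>v \<beta> l)) $ j = (\<Sum>a<q. z j $ a * (\<Sum>k<p. \<Theta> l $$ (a, k) * \<beta> l $ k))"
      using j \<Theta> \<beta> Z_dim by (simp add: scalar_prod_def lessThan_atLeast0 Z_index)
    also have "\<dots> = (\<Sum>k<p. \<Sum>a<q. z j $ a * (\<Theta> l $$ (a, k) * \<beta> l $ k))"
      unfolding sum_distrib_left by (rule sum.swap)
    also have "\<dots> = (\<Sum>k<p. \<beta> l $ k * xh j $ k)"
      using j by (simp add: xh_index sum_distrib_left mult_ac)
    finally show ?thesis .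
  qed
  have \<beta>': "\<beta> (l + 1) $ k = \<beta> l $ k - \<alpha> * (\<Sum>j<n. ((\<Sum>k<p. \<beta> l $ k * xh j $ k) - y j) * xh j $ k)"
    if k: "k < p" for k
  proof -
    define u where "u = Z *\<^sub>v (\<Theta> l *\<^sub>v \<beta> l) - Y"
    have u: "u \<in> carrier_vec n" "\<And>j. j < n \<Longrightarrow> u $ j = (\<Sum>k<p. \<beta> l $ k * xh j $ k) - y j"
      \<comment> \<open>Deleting \<open>index_mult_mat_vec\<close> keeps the product folded, so that
        \<open>pred\<close> can rewrite its entries.\<close>
      using Z_dim by (auto simp: u_def Y pred simp del: index_mult_mat_vec intro: carrier_vecI)
    have "((\<Theta> l)\<^sup>T *\<^sub>v (Z\<^sup>T *\<^sub>v u)) $ k = (\<Sum>a<q. \<Theta> l $$ (a, k) * (\<Sum>j<n. z j $ a * u $ j))"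
      using k \<Theta> u(1) Z_dim by (simp add: scalar_prod_def lessThan_atLeast0 Z_index)
    \<comment> \<open>The same interchange, now with the samples: the gradient becomes the sum of
      the \<open>xh j\<close> weighted by the residuals \<open>u\<close>.\<close>
    also have "\<dots> = (\<Sum>j<n. \<Sum>a<q. \<Theta> l $$ (a, k) * (z j $ a * u $ j))"
      unfolding sum_distrib_left by (rule sum.swap)
    also have "\<dots> = (\<Sum>j<n. u $ j * xh j $ k)"
      using k by (simp add: xh_index sum_distrib_left mult_ac)
    finally show ?thesis
      using k \<beta> \<Theta> unfolding \<beta>_step u_def[symmetric] by (simp add: u(2))
  qed
  interpret input: embedded_input n q p z x y "\<Theta> l" "\<beta> l" "xhat l"
    using z x \<Theta> \<beta> xhat by unfold_locales
  \<comment> \<open>Between the layers, Theta and beta are old and the predictions new.\<close>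
  interpret mid: embedded_input n q p z x y "\<Theta> l" "\<beta> l" xh
    using z x \<Theta> \<beta> by unfold_locales (auto simp: xh)
  \<comment> \<open>One threshold for all query scores of the second layer: the sum over
    \<open>k\<close> bounds each of its terms and also makes sense for p = 0.\<close>
  define b where "b = \<bar>\<Sum>k<p. \<beta> l $ k * xh n $ k\<bar> + (\<Sum>k<p. \<bar>xh n $ k - x n $ k\<bar>)"
  let ?P1 = "concat (map (head_pair q p) (layer1 q p))"
  let ?P2 = "concat (map (head_pair q p) (layer2 n q p \<alpha> \<eta> b))"
  have "\<bar>\<Sum>k<p. \<beta> l $ k * xh n $ k\<bar> \<le> b"
    unfolding b_def by (simp add: sum_nonneg)
  moreover have "\<bar>xh n $ k - x n $ k\<bar> \<le> b" if "k < p" for k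
    using member_le_sum[of k "{..<p}" "\<lambda>k. \<bar>xh n $ k - x n $ k\<bar>"] that by (simp add: b_def)
  moreover have "\<Theta> (l + 1) \<in> carrier_mat q p" "\<beta> (l + 1) \<in> carrier_vec p"
    unfolding \<Theta>_step \<beta>_step using \<Theta> \<beta> Z_dim X_dim by (auto intro!: carrier_vecI)
  ultimately have "attention_layer ?P2 (embedding n q p z x y (\<Theta> l) (\<beta> l) xh) =
      embedding n q p z x y (\<Theta> (l + 1)) (\<beta> (l + 1)) xh"
    by (intro mid.layer2_output \<Theta>' \<beta>')
  moreover have "attention_layer ?P1 (embedding n q p z x y (\<Theta> l) (\<beta> l) (xhat l)) =
      embedding n q p z x y (\<Theta> l) (\<beta> l) xh"
    by (rule input.layer1_output) (rule xh)
  ultimately have "double_layer_block ?P1 ?P2 (embedding n q p z x y (\<Theta> l) (\<beta> l) (xhat l)) =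
      embedding n q p z x y (\<Theta> (l + 1)) (\<beta> (l + 1)) (xhat (l + 1))"
    by (simp add: double_layer_block_def xh_def)
  moreover have "length ?P1 = 2 * p" "length ?P2 = 2 * (p + 1)"
    by (simp_all only: length_head_pairs) (simp_all add: layer1_def layer2_def)
  ultimately show ?thesis
    using attention_params_head_pairs by blast
qed

end
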